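(* Let $\ell\in\mathbb Z$ with $\ell\le 0$ and let $k\in\mathbb N_0$. Then the following limit exists, is finite, and has the value $$\lim_{n\to\infty}\frac{\mathrm{cp}(n,n+\ell,k)}{\mathrm{cp}(n,n+\ell,0)}=\frac{\phi(\ell,k)-\phi(\ell,k+1)}{\phi(\ell,0)-\phi(\ell,1)},$$ where $$\phi(\ell,j)=-(j-\ell)\sum_{i=0}^{j-1}\frac{(-1)^i}{i!}\,(j-i)^i\,e^{\,j-i}\qquad (j\in\mathbb N_0).$$
   Context: Car parking problem: a car park has $n$ spaces in a line, numbered $1,\dots,n$, and $m$ drivers arrive one after the other. Each driver has chosen a preferred space, so an assignment is a function $f:\{1,\dots,m\}\to\{1,\dots,n\}$, and there are $n^m$ assignments. Each arriving driver parks in the chosen space if it is free; otherwise the driver takes the first free space with a larger number, if there is one; if there is none, the driver fails to park and goes home. For $n,m,k\in\mathbb N_0$, $\mathrm{cp}(n,m,k)$ denotes the number of assignments for which exactly $k$ drivers fail to park. An empty sum is $0$, so $\phi(\ell,0)=0$. Only those $n$ with $n+\ell\ge 0$ are considered in the limit. *)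

theory Defs
  imports Complex_Main "HOL-Library.FuncSet"
begin

text \<open>The space taken by a driver preferring space \<open>c\<close> when the spaces in \<open>occ\<close> are
  already taken in a car park with spaces \<open>1, \<dots>, n\<close>; \<open>None\<close> means that the driver goes home.\<close>

definition park :: "nat \<Rightarrow> nat set \<Rightarrow> nat \<Rightarrow> nat option" where
  "park n occ c =
     (if c \<notin> occ then Some c
      else if \<exists>s. c < s \<and> s \<le> n \<and> s \<notin> occ
      then Some (LEAST s. c < s \<and> s \<le> n \<and> s \<notin> occ)
      else None)"

text \<open>The occupied spaces after drivers \<open>1, \<dots>, d\<close> have arrived, in this order.\<close>

primrec occupied :: "nat \<Rightarrow> (nat \<Rightarrow> nat) \<Rightarrow> nat \<Rightarrow> nat set" where
  "occupied n f 0 = {}"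
| "occupied n f (Suc d) =
     (case park n (occupied n f d) (f (Suc d)) of
        None \<Rightarrow> occupied n f d
      | Some s \<Rightarrow> insert s (occupied n f d))"

definition fails_to_park :: "nat \<Rightarrow> (nat \<Rightarrow> nat) \<Rightarrow> nat \<Rightarrow> bool" where
  "fails_to_park n f d \<longleftrightarrow> park n (occupied n f (d - 1)) (f d) = None"

definition assignments :: "nat \<Rightarrow> nat \<Rightarrow> (nat \<Rightarrow> nat) set" where
  "assignments n m = {1..m} \<rightarrow>\<^sub>E {1..n}"

definition cp :: "nat \<Rightarrow> nat \<Rightarrow> nat \<Rightarrow> nat" where
  "cp n m k = card {f \<in> assignments n m. card {d \<in> {1..m}. fails_to_park n f d} = k}"

definition phi :: "int \<Rightarrow> nat \<Rightarrow> real" where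
  "phi l j = - (real j - real_of_int l) *
     (\<Sum>i<j. (-1) ^ i / fact i * (real j - real i) ^ i * exp (real j - real i))"

end

theory Submission
  imports Defs
begin

text \<open>Write \<open>m = n + l \<le> n\<close>.  Call an assignment good if fewer than \<open>k\<close> drivers fail.  It suffices to
  understand the number of good assignments, because \<open>cp n m k\<close> is the difference of these numbers for
  \<open>k + 1\<close> and \<open>k\<close>.

  The number of failures depends only on how many drivers prefer a space beyond \<open>s\<close>, for each \<open>s\<close>.
  At most \<open>n - s\<close> of them can park, so an excess over \<open>n - s\<close> forces failures; and this bound is attained
  when \<open>s\<close> is the last space that stays free, since nobody ever drives past a free space
  (\<open>few_failures_iff\<close>).  With \<open>a = n - m + k\<close>, an assignment is therefore good iff for all
  \<open>s \<le> n\<close> more than \<open>s - a\<close> drivers prefer one of the first \<open>s\<close> spaces.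

  These assignments are counted by adding one space at a time: the drivers not preferring the last
  space form a set with an assignment of the same kind on one space fewer.  The resulting binomial recurrence
  is solved by a tail of Abel's expansion of \<open>n ^ m\<close>
  (\<open>card_assignments_above\<close>), and the solution has at most \<open>k\<close> nonzero terms, however large
  \<open>n\<close> is (\<open>card_few_failures_sum\<close>).  Dividing by \<open>n ^ (m - 1)\<close> and passing to the limit
  term by term, with \<open>(m choose j) / n ^ j\<close> tending to \<open>1 / fact j\<close> and
  \<open>((n + k - j) / n) ^ (m - j)\<close> to \<open>exp (k - j)\<close>, gives \<open>- phi l k\<close>
  (\<open>few_failures_tendsto\<close>).  The theorem is the quotient of two differences of such limits; its
  denominator \<open>(1 - l) * exp 1\<close> is positive.\<close>

section \<open>The number of failures in terms of the preferences\<close>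

lemma park_SomeD:
  assumes "park n occ c = Some t" "c \<in> {1..n}"
  shows "t \<notin> occ" "c \<le> t" "t \<le> n" "\<And>s. c \<le> s \<Longrightarrow> s < t \<Longrightarrow> s \<in> occ"
proof -
  have "t \<notin> occ \<and> c \<le> t \<and> t \<le> n \<and> (\<forall>s. c \<le> s \<longrightarrow> s < t \<longrightarrow> s \<in> occ)"
  proof (cases "c \<in> occ")
    case False
    with assms show ?thesis by (auto simp: park_def)
  next
    case True
    define P where "P s \<longleftrightarrow> c < s \<and> s \<le> n \<and> s \<notin> occ" for s
    from True assms have ex: "\<exists>s. P s" and t: "t = (LEAST s. P s)"
      by (auto simp: park_def P_def split: if_splits)
    from ex have Pt: "P t" unfolding t by (rule LeastI_ex)
    have "s \<in> occ" if "c \<le> s" "s < t" for s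
    proof (cases "s = c")
      case False
      from that(2) have "\<not> P s" unfolding t by (rule not_less_Least)
      with False that Pt show ?thesis by (auto simp: P_def)
    qed (use True in simp)
    with Pt show ?thesis by (auto simp: P_def)
  qed
  thus "t \<notin> occ" "c \<le> t" "t \<le> n" "\<And>s. c \<le> s \<Longrightarrow> s < t \<Longrightarrow> s \<in> occ"
    by blast+
qed

lemma park_NoneD:
  assumes "park n occ c = None" "c \<le> s" "s \<le> n"
  shows "s \<in> occ"
  using assms by (cases "s = c") (auto simp: park_def split: if_splits)

lemma Collect_Suc_interval:
  "{d \<in> {1..Suc m}. P d} = (if P (Suc m) then insert (Suc m) {d \<in> {1..m}. P d} else {d \<in> {1..m}. P d})"
  by (auto simp: le_Suc_eq)

lemma card_Collect_Suc_interval: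
  "card {d \<in> {1..Suc m}. P d} = card {d \<in> {1..m}. P d} + (if P (Suc m) then 1 else 0)"
  unfolding Collect_Suc_interval by simp

text \<open>A driver preferring a space beyond \<open>s\<close> either parks beyond \<open>s\<close> or fails, which gives the
  inequality.  While \<open>s\<close> is free, a driver preferring a space up to \<open>s\<close> neither fails nor parks
  beyond \<open>s\<close>, which makes it an equality.  Since \<open>0\<close> is never occupied, it counts as a free space here.\<close>

lemma occupied_invariant:
  assumes "\<And>e. e \<in> {1..d} \<Longrightarrow> f e \<in> {1..n}"
  shows "occupied n f d \<subseteq> {1..n} \<and>
    (\<forall>s. card {e \<in> {1..d}. s < f e}
       \<le> card (occupied n f d \<inter> {s<..}) + card {e \<in> {1..d}. fails_to_park n f e}) \<and>
    (\<forall>s\<le>n. s \<notin> occupied n f d \<longrightarrow>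
      card {e \<in> {1..d}. s < f e}
       = card (occupied n f d \<inter> {s<..}) + card {e \<in> {1..d}. fails_to_park n f e})"
  using assms
proof (induction d)
  case 0
  show ?case by simp
next
  case (Suc d)
  let ?O = "occupied n f d" and ?c = "f (Suc d)"
  have c: "?c \<in> {1..n}" using Suc.prems by simp
  note IH = Suc.IH[OF Suc.prems]
  have sub: "?O \<subseteq> {1..n}"
    and le: "\<And>s. card {e \<in> {1..d}. s < f e}
       \<le> card (?O \<inter> {s<..}) + card {e \<in> {1..d}. fails_to_park n f e}"
    and eq: "\<And>s. s \<le> n \<Longrightarrow> s \<notin> ?O \<Longrightarrow> card {e \<in> {1..d}. s < f e}
       = card (?O \<inter> {s<..}) + card {e \<in> {1..d}. fails_to_park n f e}"
    using IH by auto
  have fin: "finite ?O" using sub by (rule finite_subset) simp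
  show ?case
  proof (cases "park n ?O ?c")
    case None
    have fail: "fails_to_park n f (Suc d)" using None by (simp add: fails_to_park_def)
    show ?thesis unfolding card_Collect_Suc_interval
    proof (intro conjI allI impI)
      show "occupied n f (Suc d) \<subseteq> {1..n}" using None sub by simp
    next
      fix s
      show "card {e \<in> {1..d}. s < f e} + (if s < f (Suc d) then 1 else 0)
       \<le> card (occupied n f (Suc d) \<inter> {s<..}) + (card {e \<in> {1..d}. fails_to_park n f e}
           + (if fails_to_park n f (Suc d) then 1 else 0))"
        using le[of s] fail None by simp
    next
      fix s assume s: "s \<le> n" "s \<notin> occupied n f (Suc d)"
      hence s': "s \<notin> ?O" using None by simp
      have "s < ?c" using park_NoneD[OF None _ s(1)] s' by (meson not_le)
      thus "card {e \<in> {1..d}. s < f e} + (if s < f (Suc d) then 1 else 0)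
       = card (occupied n f (Suc d) \<inter> {s<..}) + (card {e \<in> {1..d}. fails_to_park n f e}
           + (if fails_to_park n f (Suc d) then 1 else 0))"
        using eq[OF s(1) s'] fail None by simp
    qed
  next
    case (Some t)
    note t = park_SomeD[OF Some c]
    have nofail: "\<not> fails_to_park n f (Suc d)" using Some by (simp add: fails_to_park_def)
    have occ: "card (occupied n f (Suc d) \<inter> {s<..}) = card (?O \<inter> {s<..}) + (if s < t then 1 else 0)" for s
      using Some t(1) fin by (auto simp: Int_insert_left)
    show ?thesis unfolding card_Collect_Suc_interval occ
    proof (intro conjI allI impI)
      show "occupied n f (Suc d) \<subseteq> {1..n}" using Some sub t c by auto
    next
      fix s
      show "card {e \<in> {1..d}. s < f e} + (if s < f (Suc d) then 1 else 0)
       \<le> card (?O \<inter> {s<..}) + (if s < t then 1 else 0)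
         + (card {e \<in> {1..d}. fails_to_park n f e} + (if fails_to_park n f (Suc d) then 1 else 0))"
        using le[of s] nofail t(2) by simp
    next
      fix s assume s: "s \<le> n" "s \<notin> occupied n f (Suc d)"
      hence s': "s \<notin> ?O" "s \<noteq> t" using Some by auto
      have "s < ?c \<longleftrightarrow> s < t" using t(2) t(4)[of s] s' by fastforce
      thus "card {e \<in> {1..d}. s < f e} + (if s < f (Suc d) then 1 else 0)
       = card (?O \<inter> {s<..}) + (if s < t then 1 else 0)
         + (card {e \<in> {1..d}. fails_to_park n f e} + (if fails_to_park n f (Suc d) then 1 else 0))"
        using eq[OF s(1) s'(1)] nofail by simp
    qed
  qed
qed

text \<open>The numbers of drivers preferring a space beyond \<open>s\<close> bound the number of failures from below for every
  \<open>s\<close>.  The bound is sharp for the last space free at the end, beyond which all \<open>n - s\<close> spaces are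
  taken; if the car park is full, \<open>s = 0\<close> takes this part.\<close>

lemma few_failures_iff:
  assumes f: "f \<in> assignments n m"
  shows "card {d \<in> {1..m}. fails_to_park n f d} < k
    \<longleftrightarrow> (\<forall>s\<le>n. card {d \<in> {1..m}. s < f d} < n - s + k)"
proof -
  let ?O = "occupied n f m" and ?w = "card {d \<in> {1..m}. fails_to_park n f d}"
  have "\<And>e. e \<in> {1..m} \<Longrightarrow> f e \<in> {1..n}" using f by (auto simp: assignments_def)
  note inv = occupied_invariant[OF this]
  have sub: "?O \<subseteq> {1..n}"
    and le: "\<And>s. card {e \<in> {1..m}. s < f e} \<le> card (?O \<inter> {s<..}) + ?w"
    and eq: "\<And>s. s \<le> n \<Longrightarrow> s \<notin> ?O \<Longrightarrow>
               card {e \<in> {1..m}. s < f e} = card (?O \<inter> {s<..}) + ?w"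
    using inv[of m] by auto
  have bound: "card (?O \<inter> {s<..}) \<le> n - s" for s
  proof -
    have "card (?O \<inter> {s<..}) \<le> card {s<..n}" using sub by (intro card_mono) auto
    thus ?thesis by simp
  qed
  define s where "s = Max ({0..n} - ?O)"
  have "0 \<in> {0..n} - ?O" using sub by auto
  hence "s \<in> {0..n} - ?O" unfolding s_def by (intro Max_in) auto
  hence s: "s \<le> n" "s \<notin> ?O" by auto
  have "u \<in> ?O" if "s < u" "u \<le> n" for u
    using that Max_ge[of "{0..n} - ?O" u] by (fastforce simp: s_def)
  hence "?O \<inter> {s<..} = {s<..n}" using sub by auto
  hence "card {d \<in> {1..m}. s < f d} = n - s + ?w" using eq[OF s] by simp
  show ?thesis
  proof
    assume "?w < k"
    show "\<forall>s\<le>n. card {d \<in> {1..m}. s < f d} < n - s + k"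
      using le bound \<open>?w < k\<close> by (meson add_le_less_mono le_less_trans order_le_less_trans)
  next
    assume "\<forall>s\<le>n. card {d \<in> {1..m}. s < f d} < n - s + k"
    thus "?w < k" using s(1) \<open>card {d \<in> {1..m}. s < f d} = n - s + ?w\<close> by fastforce
  qed
qed

section \<open>A tail of Abel's binomial expansion\<close>

text \<open>Abel's identity with \<open>x = a\<close> and \<open>y = n - a\<close> reads
  \<open>n ^ m = (\<Sum>i\<le>m. (m choose i) * a * (a + i) ^ (i - 1) * (n - a - i) ^ (m - i))\<close>; this is the part of the sum with
  \<open>i > n - a\<close>.  The exponent \<open>i - 1\<close> is written as a quotient, so that \<open>i = 0\<close> gives \<open>1\<close> when
  \<open>a > 0\<close>.\<close>

definition abel_tail :: "nat \<Rightarrow> nat \<Rightarrow> nat \<Rightarrow> real" where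
  "abel_tail a n m =
     (\<Sum>i\<le>m. real (m choose i) *
        (if n < i + a then real a * real (a + i) ^ i / real (a + i) else 0) *
        (real n - real a - real i) ^ (m - i))"

text \<open>An \<open>m\<close>-th finite difference annihilates polynomials of degree less than \<open>m\<close>: each difference
  lowers the degree.\<close>

lemma alternating_binomial_sum_eq_0:
  fixes x :: "'a :: comm_ring_1"
  assumes "p < m"
  shows "(\<Sum>i\<le>m. of_nat (m choose i) * (-1) ^ i * (x + of_nat i) ^ p) = 0"
  using assms
proof (induction m arbitrary: p x)
  case 0
  thus ?case by simp
next
  case (Suc m)
  have pascal: "(\<Sum>i\<le>Suc m. of_nat (Suc m choose i) * (-1) ^ i * (x + of_nat i) ^ p)
    = (\<Sum>i\<le>m. of_nat (m choose i) * (-1) ^ i * ((x + of_nat i) ^ p - (x + of_nat i + 1) ^ p))"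
  proof -
    let ?h = "\<lambda>i. (-1) ^ i * (x + of_nat i) ^ p"
    have "(\<Sum>i\<le>Suc m. of_nat (Suc m choose i) * ?h i)
        = ?h 0 + (\<Sum>i\<le>m. of_nat (m choose i) * ?h (Suc i)) + (\<Sum>i\<le>m. of_nat (m choose Suc i) * ?h (Suc i))"
      by (subst sum.atMost_Suc_shift) (simp add: algebra_simps sum.distrib sum_subtractf sum_negf)
    also have "?h 0 + (\<Sum>i\<le>m. of_nat (m choose i) * ?h (Suc i)) + (\<Sum>i\<le>m. of_nat (m choose Suc i) * ?h (Suc i))
       = (\<Sum>i\<le>m. of_nat (m choose i) * ?h (Suc i)) + (\<Sum>i\<le>Suc m. of_nat (m choose i) * ?h i)"
      by (simp add: sum.atMost_Suc_shift[of "\<lambda>i. of_nat (m choose i) * ?h i"] add_ac del: sum.atMost_Suc)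
    also have "(\<Sum>i\<le>Suc m. of_nat (m choose i) * ?h i) = (\<Sum>i\<le>m. of_nat (m choose i) * ?h i)"
      by (simp add: binomial_eq_0)
    finally show ?thesis
      by (simp add: algebra_simps sum.distrib sum_subtractf sum_negf)
  qed
  have diff: "y ^ p - (y + 1) ^ p = - (\<Sum>q<p. of_nat (p choose q) * y ^ q)" for y :: 'a
    unfolding binomial_ring by (simp add: lessThan_Suc_atMost[symmetric])
  have "(\<Sum>i\<le>m. of_nat (m choose i) * (-1) ^ i * (\<Sum>q<p. of_nat (p choose q) * (x + of_nat i) ^ q))
     = (\<Sum>q<p. of_nat (p choose q) * (\<Sum>i\<le>m. of_nat (m choose i) * (-1) ^ i * (x + of_nat i) ^ q))"
    unfolding sum_distrib_left by (subst sum.swap) (simp add: mult_ac)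
  also have "\<dots> = 0" using Suc by simp
  finally show ?case unfolding pascal diff by (simp add: sum_negf)
qed

text \<open>For \<open>n = 0\<close> the base \<open>- a - i\<close> of the second power is the negative of that of the first, so for \<open>m > 0\<close> both
  merge into \<open>(a + i) ^ (m - 1)\<close> and the sum is an \<open>m\<close>-th finite difference of a polynomial of degree
  \<open>m - 1\<close>.\<close>

lemma abel_tail_0:
  assumes "0 < a"
  shows "abel_tail a 0 m = (if m = 0 then 1 else 0)"
proof (cases m)
  case 0
  with assms show ?thesis by (simp add: abel_tail_def)
next
  case (Suc q)
  have "real (m choose i) *
        (if 0 < i + a then real a * real (a + i) ^ i / real (a + i) else 0) *
        (real 0 - real a - real i) ^ (m - i)
      = (-1) ^ m * real a * (real (m choose i) * (-1) ^ i * (real a + real i) ^ q)"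
    if "i \<in> {..m}" for i
  proof -
    have y: "real a + real i \<noteq> 0" using assms by linarith
    have "(real 0 - real a - real i) ^ (m - i) = (-1) ^ (m - i) * (real a + real i) ^ (m - i)"
      by (subst power_mult_distrib[symmetric]) (simp add: algebra_simps)
    moreover have "(-1 :: real) ^ (m - i) = (-1) ^ m * (-1) ^ i"
      using that by (auto simp: minus_one_power_iff)
    moreover have "(real a + real i) ^ i * (real a + real i) ^ (m - i) = (real a + real i) ^ q * (real a + real i)"
      using that Suc by (simp flip: power_add power_Suc2)
    ultimately show ?thesis using y assms by (simp add: field_simps)
  qed
  hence "abel_tail a 0 m
      = (-1) ^ m * real a * (\<Sum>i\<le>m. real (m choose i) * (-1) ^ i * (real a + real i) ^ q)"
    unfolding abel_tail_def sum_distrib_left by (intro sum.cong) auto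
  also have "(\<Sum>i\<le>m. real (m choose i) * (-1) ^ i * (real a + real i) ^ q) = 0"
    using alternating_binomial_sum_eq_0[of q m "real a"] Suc by simp
  finally show ?thesis using Suc by simp
qed

text \<open>Choosing an \<open>r\<close>-set and an \<open>i\<close>-set inside it amounts to choosing the \<open>i\<close>-set first; the
  sum over \<open>r\<close> is then a binomial expansion.\<close>

lemma binomial_transform_shift:
  fixes g h :: "nat \<Rightarrow> 'a :: comm_semiring_1"
  shows "(\<Sum>r\<le>m. of_nat (m choose r) * (\<Sum>i\<le>r. of_nat (r choose i) * g i * h i ^ (r - i)))
       = (\<Sum>i\<le>m. of_nat (m choose i) * g i * (h i + 1) ^ (m - i))"
proof -
  have "(\<Sum>r\<le>m. of_nat (m choose r) * (\<Sum>i\<le>r. of_nat (r choose i) * g i * h i ^ (r - i)))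
      = (\<Sum>r\<le>m. \<Sum>i\<le>r. of_nat ((m choose i) * (m - i choose (r - i))) * g i * h i ^ (r - i))"
    unfolding sum_distrib_left
    by (intro sum.cong refl) (simp add: choose_mult[symmetric] mult_ac)
  also have "\<dots> = (\<Sum>i\<le>m. \<Sum>r=i..m. of_nat ((m choose i) * (m - i choose (r - i))) * g i * h i ^ (r - i))"
    by (subst (1 2) sum.Sigma, simp_all)
       (rule sum.reindex_bij_witness[of _ prod.swap prod.swap]; auto)
  also have "\<dots> = (\<Sum>i\<le>m. of_nat (m choose i) * g i * (h i + 1) ^ (m - i))"
  proof (intro sum.cong refl)
    fix i assume i: "i \<in> {..m}"
    have "(\<Sum>r=i..m. of_nat ((m choose i) * (m - i choose (r - i))) * g i * h i ^ (r - i))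
       = (\<Sum>r\<le>m - i. of_nat ((m choose i) * (m - i choose r)) * g i * h i ^ r)"
      by (rule sum.reindex_bij_witness[of _ "\<lambda>r. r + i" "\<lambda>r. r - i"]) (use i in auto)
    also have "\<dots> = of_nat (m choose i) * g i * (h i + 1) ^ (m - i)"
      unfolding binomial_ring sum_distrib_left by (simp add: mult_ac)
    finally show "(\<Sum>r=i..m. of_nat ((m choose i) * (m - i choose (r - i))) * g i * h i ^ (r - i))
       = of_nat (m choose i) * g i * (h i + 1) ^ (m - i)" .
  qed
  finally show ?thesis .
qed

text \<open>The binomial transform raises \<open>n - a - i\<close> by one.  The transformed tail still starts at \<open>i = n + 1 - a\<close>, one term
  too early for \<open>n + 1\<close>, but this term carries a positive power of \<open>0\<close>; the hypothesis makes the power positive.\<close>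

lemma abel_tail_Suc:
  assumes "Suc n < m + a"
  shows "abel_tail a (Suc n) m = (\<Sum>r\<le>m. real (m choose r) * abel_tail a n r)"
proof -
  have "(\<Sum>r\<le>m. real (m choose r) * abel_tail a n r)
     = (\<Sum>i\<le>m. real (m choose i) * (if n < i + a then real a * real (a + i) ^ i / real (a + i) else 0)
          * (real n - real a - real i + 1) ^ (m - i))"
    unfolding abel_tail_def by (rule binomial_transform_shift)
  also have "\<dots> = abel_tail a (Suc n) m"
    unfolding abel_tail_def
  proof (intro sum.cong refl)
    fix i assume "i \<in> {..m}"
    show "real (m choose i) * (if n < i + a then real a * real (a + i) ^ i / real (a + i) else 0)
          * (real n - real a - real i + 1) ^ (m - i)
       = real (m choose i) * (if Suc n < i + a then real a * real (a + i) ^ i / real (a + i) else 0)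
          * (real (Suc n) - real a - real i) ^ (m - i)"
    proof (cases "Suc n = i + a")
      case True
      hence "real n - real a - real i + 1 = 0" by linarith
      moreover have "m - i > 0" using True assms by linarith
      ultimately show ?thesis using True by simp
    next
      case False
      hence "Suc n < i + a \<longleftrightarrow> n < i + a" by linarith
      thus ?thesis by (simp add: algebra_simps)
    qed
  qed
  finally show ?thesis by simp
qed

section \<open>Counting assignments by adding the last space\<close>

text \<open>The set of drivers is arbitrary because the recursion on \<open>n\<close> removes the drivers who prefer the last
  space.  The condition is written additively since \<open>s - a\<close> may be negative.\<close>

definition assignments_above :: "nat \<Rightarrow> nat \<Rightarrow> 'a set \<Rightarrow> ('a \<Rightarrow> nat) set" where
  "assignments_above a n X =
     {f \<in> X \<rightarrow>\<^sub>E {1..n}. \<forall>s\<le>n. s < card {x \<in> X. f x \<le> s} + a}"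

lemma sum_Pow_card:
  fixes \<psi> :: "nat \<Rightarrow> 'b :: semiring_1"
  assumes "finite X"
  shows "(\<Sum>Y\<in>Pow X. \<psi> (card Y)) = (\<Sum>r\<le>card X. of_nat (card X choose r) * \<psi> r)"
proof -
  have "(\<Sum>Y\<in>Pow X. \<psi> (card Y)) = (\<Sum>r\<le>card X. \<Sum>Y\<in>{Y \<in> Pow X. card Y = r}. \<psi> (card Y))"
    by (rule sum.group[symmetric]) (use assms card_mono in auto)
  also have "\<dots> = (\<Sum>r\<le>card X. of_nat (card X choose r) * \<psi> r)"
    by (intro sum.cong refl) (simp add: Pow_def n_subsets[OF assms])
  finally show ?thesis .
qed

text \<open>An assignment amounts to the set \<open>Y\<close> of drivers who do not prefer the last space together with its
  restriction to \<open>Y\<close>.  The constraints for \<open>s \<le> n\<close> only concern this restriction, and the one for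
  \<open>s = n + 1\<close> is the hypothesis.\<close>

lemma assignments_above_Suc:
  assumes X: "finite X" and m: "Suc n < card X + a"
  shows "card (assignments_above a (Suc n) X) = (\<Sum>Y\<in>Pow X. card (assignments_above a n Y))"
proof -
  let ?S = "SIGMA Y:Pow X. assignments_above a n Y"
  let ?to = "\<lambda>f. ({x \<in> X. f x \<le> n}, restrict f {x \<in> X. f x \<le> n})"
  let ?from = "\<lambda>(Y, g). \<lambda>x\<in>X. if x \<in> Y then g x else Suc n"
  have "bij_betw ?to (assignments_above a (Suc n) X) ?S"
  proof (rule bij_betw_byWitness[where f' = ?from])
    show "\<forall>f\<in>assignments_above a (Suc n) X. ?from (?to f) = f"
    proof
      fix f assume "f \<in> assignments_above a (Suc n) X"
      hence f: "f \<in> X \<rightarrow>\<^sub>E {1..Suc n}" by (simp add: assignments_above_def)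
      have "f x = Suc n" if "x \<in> X" "\<not> f x \<le> n" for x
        using that PiE_mem[OF f that(1)] by simp
      thus "?from (?to f) = f" by (intro PiE_ext[OF _ f]) (use f in \<open>auto dest: PiE_mem\<close>)
    qed
  next
    show "\<forall>p\<in>?S. ?to (?from p) = p"
    proof
      fix p assume "p \<in> ?S"
      then obtain Y g where p: "p = (Y, g)" "Y \<subseteq> X" and g: "g \<in> Y \<rightarrow>\<^sub>E {1..n}"
        by (auto simp: assignments_above_def)
      have "{x \<in> X. ?from p x \<le> n} = Y" using g p by (auto dest: PiE_mem)
      moreover have "restrict (?from p) Y = g"
        by (rule PiE_ext[OF _ g]) (use p PiE_mem[OF g] in auto)
      ultimately show "?to (?from p) = p" using p(1) by simp
    qed
  next
    show "?to ` assignments_above a (Suc n) X \<subseteq> ?S"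
    proof (intro image_subsetI)
      fix f assume f: "f \<in> assignments_above a (Suc n) X"
      have "{x \<in> {x \<in> X. f x \<le> n}. restrict f {x \<in> X. f x \<le> n} x \<le> s} = {x \<in> X. f x \<le> s}" if "s \<le> n" for s
        using that by auto
      moreover have "restrict f {x \<in> X. f x \<le> n} \<in> {x \<in> X. f x \<le> n} \<rightarrow>\<^sub>E {1..n}"
        using f by (auto simp: assignments_above_def dest: PiE_mem)
      ultimately show "?to f \<in> ?S" using f by (auto simp: assignments_above_def)
    qed
  next
    show "?from ` ?S \<subseteq> assignments_above a (Suc n) X"
    proof (intro image_subsetI)
      fix p assume "p \<in> ?S"
      then obtain Y g where p: "p = (Y, g)" "Y \<subseteq> X" and g: "g \<in> assignments_above a n Y"
        by auto
      have g': "g \<in> Y \<rightarrow>\<^sub>E {1..n}" using g by (simp add: assignments_above_def)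
      have mem: "?from p \<in> X \<rightarrow>\<^sub>E {1..Suc n}" using g' p by (fastforce dest: PiE_mem)
      have "{x \<in> X. ?from p x \<le> s} = {x \<in> Y. g x \<le> s}" if "s \<le> n" for s
        using that p by auto
      moreover have "{x \<in> X. ?from p x \<le> Suc n} = X" using mem by (auto dest: PiE_mem)
      ultimately have "s < card {x \<in> X. ?from p x \<le> s} + a" if "s \<le> Suc n" for s
        using that g m by (cases "s = Suc n") (auto simp: assignments_above_def)
      with mem show "?from p \<in> assignments_above a (Suc n) X"
        by (simp add: assignments_above_def)
    qed
  qed
  hence "card (assignments_above a (Suc n) X) = card ?S" by (rule bij_betw_same_card)
  also have "\<dots> = (\<Sum>Y\<in>Pow X. card (assignments_above a n Y))"
  proof (rule card_SigmaI)
    show "\<forall>Y\<in>Pow X. finite (assignments_above a n Y)"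
    proof
      fix Y assume "Y \<in> Pow X"
      hence "finite (Y \<rightarrow>\<^sub>E {1..n})" using X by (auto intro!: finite_PiE dest: finite_subset)
      thus "finite (assignments_above a n Y)" by (simp add: assignments_above_def)
    qed
  qed (use X in simp)
  finally show ?thesis .
qed

lemma card_assignments_above:
  assumes "0 < a" "finite X"
  shows "real (card (assignments_above a n X)) = abel_tail a n (card X)"
  using assms(2)
proof (induction n arbitrary: X)
  case 0
  show ?case
  proof (cases "X = {}")
    case True
    thus ?thesis using assms(1) by (simp add: abel_tail_0 assignments_above_def)
  next
    case False
    hence "assignments_above a 0 X = {}"
      by (auto simp: assignments_above_def PiE_eq_empty_iff)
    thus ?thesis using assms(1) False 0 by (simp add: abel_tail_0)
  qed
next
  case (Suc n)
  show ?case
  proof (cases "Suc n < card X + a")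
    case True
    have "real (card (assignments_above a (Suc n) X)) = (\<Sum>Y\<in>Pow X. abel_tail a n (card Y))"
      unfolding assignments_above_Suc[OF Suc.prems True] of_nat_sum
      by (intro sum.cong refl Suc.IH) (use Suc.prems finite_subset in auto)
    also have "\<dots> = abel_tail a (Suc n) (card X)"
      by (simp add: sum_Pow_card[OF Suc.prems] abel_tail_Suc[OF True])
    finally show ?thesis .
  next
    case False
    have "card {x \<in> X. f x \<le> Suc n} \<le> card X" for f :: "'a \<Rightarrow> nat"
      using Suc.prems by (intro card_mono) auto
    hence "\<not> Suc n < card {x \<in> X. f x \<le> Suc n} + a" for f :: "'a \<Rightarrow> nat"
      using False by (meson add_le_mono1 less_le_trans)
    hence "assignments_above a (Suc n) X = {}" by (auto simp: assignments_above_def)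
    moreover have "abel_tail a (Suc n) (card X) = 0"
      unfolding abel_tail_def using False by (intro sum.neutral) auto
    ultimately show ?thesis by simp
  qed
qed

section \<open>The number of assignments with few failures\<close>

definition few_failures :: "nat \<Rightarrow> nat \<Rightarrow> nat \<Rightarrow> (nat \<Rightarrow> nat) set" where
  "few_failures n m k =
     {f \<in> assignments n m. card {d \<in> {1..m}. fails_to_park n f d} < k}"

lemma finite_few_failures: "finite (few_failures n m k)"
  by (rule finite_subset[of _ "assignments n m"])
     (auto simp: few_failures_def assignments_def intro: finite_PiE)

lemma cp_eq_diff:
  "real (cp n m k) = real (card (few_failures n m (Suc k))) - real (card (few_failures n m k))"
proof -
  have "{f \<in> assignments n m. card {d \<in> {1..m}. fails_to_park n f d} = k}
      = few_failures n m (Suc k) - few_failures n m k"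
    by (auto simp: few_failures_def)
  moreover have "few_failures n m k \<subseteq> few_failures n m (Suc k)"
    by (auto simp: few_failures_def)
  ultimately show ?thesis
    unfolding cp_def
    by (simp add: card_Diff_subset finite_few_failures of_nat_diff card_mono)
qed

lemma card_few_failures:
  assumes "m \<le> n" "0 < k"
  shows "real (card (few_failures n m k)) = abel_tail (n - m + k) n m"
proof -
  have "card {d \<in> {1..m}. s < f d} < n - s + k \<longleftrightarrow> s < card {d \<in> {1..m}. f d \<le> s} + (n - m + k)"
    if "s \<le> n" for s and f :: "nat \<Rightarrow> nat"
  proof -
    have "card ({d \<in> {1..m}. s < f d} \<union> {d \<in> {1..m}. f d \<le> s})
        = card {d \<in> {1..m}. s < f d} + card {d \<in> {1..m}. f d \<le> s}"
      by (rule card_Un_disjoint) auto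
    moreover have "{d \<in> {1..m}. s < f d} \<union> {d \<in> {1..m}. f d \<le> s} = {1..m}" by auto
    ultimately have "card {d \<in> {1..m}. s < f d} + card {d \<in> {1..m}. f d \<le> s} = m" by simp
    thus ?thesis using that assms by linarith
  qed
  hence "(\<forall>s\<le>n. card {d \<in> {1..m}. s < f d} < n - s + k)
      \<longleftrightarrow> (\<forall>s\<le>n. s < card {d \<in> {1..m}. f d \<le> s} + (n - m + k))" for f :: "nat \<Rightarrow> nat"
    by blast
  hence "few_failures n m k = assignments_above (n - m + k) n {1..m}"
    unfolding few_failures_def assignments_above_def assignments_def[symmetric]
    by (intro Collect_cong conj_cong refl) (simp only: few_failures_iff)
  thus ?thesis using card_assignments_above[of "n - m + k" "{1..m}" n] assms by simp
qed

text \<open>Put \<open>j = m - i\<close> in the tail for \<open>a = n - m + k\<close>: the condition \<open>i > n - a = m - k\<close> becomes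
  \<open>j < k\<close>, so the number of terms does not grow with \<open>n\<close>.\<close>

lemma card_few_failures_sum:
  assumes "k \<le> m" "m \<le> n"
  shows "real (card (few_failures n m k)) =
    (real (n - m) + real k) * (\<Sum>j<k. real (m choose j) * (-1) ^ j * (real k - real j) ^ j
        * (real n + real k - real j) ^ (m - j) / (real n + real k - real j))"
proof (cases "k = 0")
  case True
  thus ?thesis by (simp add: few_failures_def)
next
  case False
  let ?a = "n - m + k"
  let ?t = "\<lambda>i. real (m choose i) *
        (if n < i + ?a then real ?a * real (?a + i) ^ i / real (?a + i) else 0) *
        (real n - real ?a - real i) ^ (m - i)"
  have "real (card (few_failures n m k)) = (\<Sum>i\<le>m. ?t i)"
    using card_few_failures[OF assms(2), of k] False by (simp add: abel_tail_def)
  also have "\<dots> = (\<Sum>i\<in>{m-k<..m}. ?t i)"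
    by (rule sum.mono_neutral_right) (use assms in auto)
  also have "\<dots> = (\<Sum>j<k. (real (n - m) + real k) * (real (m choose j) * (-1) ^ j * (real k - real j) ^ j
        * (real n + real k - real j) ^ (m - j) / (real n + real k - real j)))"
  proof (rule sum.reindex_bij_witness[of _ "\<lambda>j. m - j" "\<lambda>i. m - i"])
    fix i assume i: "i \<in> {m-k<..m}"
    define j where "j = m - i"
    have j: "i = m - j" "j \<le> m" "j < k" using i assms by (auto simp: j_def)
    have "real n - real ?a - real i = - (real k - real j)"
      and e: "real (?a + i) = real n + real k - real j"
      using j assms by (auto simp: of_nat_diff)
    hence "(real n - real ?a - real i) ^ j = (-1) ^ j * (real k - real j) ^ j"
      by (metis mult_minus1 power_mult_distrib)
    moreover have "n < i + ?a" using j assms by linarith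
    moreover have "m choose i = m choose j" using j binomial_symmetric by metis
    ultimately show "(real (n - m) + real k) * (real (m choose (m - i)) * (-1) ^ (m - i) * (real k - real (m - i)) ^ (m - i)
        * (real n + real k - real (m - i)) ^ (m - (m - i)) / (real n + real k - real (m - i))) = ?t i"
      unfolding j_def[symmetric] e using j by simp
  qed (use assms in auto)
  finally show ?thesis by (simp add: sum_distrib_left)
qed

section \<open>Asymptotics\<close>

lemma binomial_div_power_tendsto:
  "(\<lambda>n. real (n - p choose j) / real n ^ j) \<longlonglongrightarrow> 1 / fact j"
proof -
  have lim: "(\<lambda>n. 1 - (real p + real i) / real n) \<longlonglongrightarrow> 1" for i
    using tendsto_diff[OF tendsto_const lim_const_over_n[of "real p + real i"], of 1] by simp
  have "(\<lambda>n. (\<Prod>i<j. 1 - (real p + real i) / real n) / fact j) \<longlonglongrightarrow> (\<Prod>i<j. 1) / fact j"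
    by (intro tendsto_intros lim) simp
  moreover have "\<forall>\<^sub>F n in sequentially.
      (\<Prod>i<j. 1 - (real p + real i) / real n) / fact j = real (n - p choose j) / real n ^ j"
    using eventually_ge_at_top[of "Suc (p + j)"]
  proof eventually_elim
    case (elim n)
    have "real (n - p choose j) = (\<Prod>i<j. real (n - p) - real i) / fact j"
      using gbinomial_prod_rev[of "real (n - p)" j] by (simp add: binomial_gbinomial atLeast0LessThan)
    also have "(\<Prod>i<j. real (n - p) - real i) = (\<Prod>i<j. real n * (1 - (real p + real i) / real n))"
      using elim by (intro prod.cong) (auto simp: field_simps of_nat_diff)
    also have "\<dots> = real n ^ j * (\<Prod>i<j. 1 - (real p + real i) / real n)"
      by (simp add: prod.distrib)
    finally show ?case using elim by (simp add: field_simps)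
  qed
  ultimately show ?thesis by (simp add: filterlim_cong[OF refl refl])
qed

lemma power_ratio_tendsto_exp:
  "(\<lambda>n. ((real n + c) / real n) ^ (n - q)) \<longlonglongrightarrow> exp c"
proof -
  have "(\<lambda>n. 1 + c / real n) \<longlonglongrightarrow> 1"
    using tendsto_add[OF tendsto_const lim_const_over_n[of c], of 1] by simp
  hence "(\<lambda>n. (1 + c / real n) ^ n / (1 + c / real n) ^ q) \<longlonglongrightarrow> exp c / 1 ^ q"
    by (intro tendsto_intros tendsto_exp_limit_sequentially) auto
  moreover have "\<forall>\<^sub>F n in sequentially.
     (1 + c / real n) ^ n / (1 + c / real n) ^ q = ((real n + c) / real n) ^ (n - q)"
    using eventually_gt_at_top[of "q + nat \<lceil>\<bar>c\<bar>\<rceil>"]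
  proof eventually_elim
    case (elim n)
    have "real n + c \<noteq> 0" "n > 0" using elim by linarith+
    moreover have "1 + c / real n = (real n + c) / real n" using \<open>n > 0\<close> by (simp add: field_simps)
    ultimately show ?case using elim by (simp add: power_diff)
  qed
  ultimately show ?thesis by (simp add: filterlim_cong[OF refl refl])
qed

text \<open>The normalising factor is \<open>n ^ (n - p - 1)\<close>, written as a quotient.  In \<open>?T n j\<close> below, the powers of \<open>n\<close> are distributed
  so that every factor converges.\<close>

lemma few_failures_tendsto:
  "(\<lambda>n. real n * real (card (few_failures n (n - p) k)) / real n ^ (n - p)) \<longlonglongrightarrow> - phi (- int p) k"
proof -
  let ?T = "\<lambda>n j. (-1) ^ j * (real k - real j) ^ j * (real (n - p choose j) / real n ^ j)
      * ((real n + (real k - real j)) / real n) ^ (n - (p + j)) / ((real n + (real k - real j)) / real n)"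
  have lim: "(\<lambda>n. (real n + c) / real n) \<longlonglongrightarrow> 1" for c
  proof (rule Lim_transform_eventually)
    show "(\<lambda>n. 1 + c / real n) \<longlonglongrightarrow> 1"
      using tendsto_add[OF tendsto_const lim_const_over_n[of c], of 1] by simp
    show "\<forall>\<^sub>F n in sequentially. 1 + c / real n = (real n + c) / real n"
      using eventually_gt_at_top[of 0] by eventually_elim (simp add: field_simps)
  qed
  have "(\<lambda>n. (real p + real k) * (\<Sum>j<k. ?T n j)) \<longlonglongrightarrow>
      (real p + real k) * (\<Sum>j<k. (-1) ^ j * (real k - real j) ^ j * (1 / fact j) * exp (real k - real j) / 1)"
    by (intro tendsto_intros binomial_div_power_tendsto power_ratio_tendsto_exp lim) auto
  also have "(real p + real k) * (\<Sum>j<k. (-1) ^ j * (real k - real j) ^ j * (1 / fact j) * exp (real k - real j) / 1)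
      = - phi (- int p) k"
    unfolding phi_def minus_mult_left minus_minus by (simp add: mult_ac)
  finally have main: "(\<lambda>n. (real p + real k) * (\<Sum>j<k. ?T n j)) \<longlonglongrightarrow> - phi (- int p) k" .
  have "\<forall>\<^sub>F n in sequentially. (real p + real k) * (\<Sum>j<k. ?T n j)
     = real n * real (card (few_failures n (n - p) k)) / real n ^ (n - p)"
    using eventually_gt_at_top[of "p + k"]
  proof eventually_elim
    case (elim n)
    let ?F = "\<lambda>j. real (n - p choose j) * (-1) ^ j * (real k - real j) ^ j
        * (real n + real k - real j) ^ (n - p - j) / (real n + real k - real j)"
    have summand: "?T n j = ?F j * (real n / real n ^ (n - p))"
      if "j \<in> {..<k}" for j
    proof -
      have "real n ^ (n - p) = real n ^ j * real n ^ (n - (p + j))"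
        using elim that by (simp flip: power_add)
      moreover have "real n > 0" "real n + (real k - real j) > 0" using elim that by auto
      ultimately show ?thesis by (simp add: power_divide field_simps)
    qed
    have "n - (n - p) = p" "k \<le> n - p" using elim by auto
    hence "real (card (few_failures n (n - p) k)) = (real p + real k) * (\<Sum>j<k. ?F j)"
      using card_few_failures_sum[of k "n - p" n] by simp
    moreover have "(\<Sum>j<k. ?T n j) = (\<Sum>j<k. ?F j) * (real n / real n ^ (n - p))"
      unfolding sum_distrib_right by (rule sum.cong[OF refl summand])
    ultimately show ?case by (simp only: times_divide_eq_right) (simp only: mult_ac)
  qed
  with main show ?thesis by (rule Lim_transform_eventually)
qed

theorem mainTheorem4:
  fixes l :: int and k :: nat
  assumes "l \<le> 0"
  shows "(\<lambda>n::nat. real (cp n (nat (int n + l)) k) / real (cp n (nat (int n + l)) 0))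
           \<longlonglongrightarrow> (phi l k - phi l (k + 1)) / (phi l 0 - phi l 1)"
proof -
  define p where "p = nat (- l)"
  have l: "l = - int p" using assms by (simp add: p_def)
  have m: "nat (int n + l) = n - p" for n by (simp add: l)
  let ?c = "\<lambda>k n. real n * real (cp n (n - p) k) / real n ^ (n - p)"
  have cp: "?c k \<longlonglongrightarrow> phi l k - phi l (k + 1)" for k
    using tendsto_diff[OF few_failures_tendsto[of p "Suc k"] few_failures_tendsto[of p k]]
    by (simp add: cp_eq_diff l right_diff_distrib diff_divide_distrib)
  have "phi l 0 - phi l 1 = (1 - real_of_int l) * exp 1" by (simp add: phi_def algebra_simps)
  moreover have "1 - real_of_int l > 0" using assms by linarith
  ultimately have "phi l 0 - phi l 1 \<noteq> 0" by simp
  hence "(\<lambda>n. ?c k n / ?c 0 n) \<longlonglongrightarrow> (phi l k - phi l (k + 1)) / (phi l 0 - phi l 1)"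
    using tendsto_divide[OF cp[of k] cp[of 0]] by simp
  moreover have "\<forall>\<^sub>F n in sequentially. ?c k n / ?c 0 n = real (cp n (n - p) k) / real (cp n (n - p) 0)"
    using eventually_gt_at_top[of 0] by eventually_elim simp
  ultimately show ?thesis unfolding m by (rule Lim_transform_eventually)
qed

end
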